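(* Let $K\subset\mathbb{R}^n$ be a closed convex cone with $E_K\ne\emptyset$. The following are equivalent: (i) $0\notin\operatorname{cl}\operatorname{aff}(E_K)$; (ii) there exist $\nu\in\mathbb{R}^n\setminus\{0\}$ and a real number $c\ne0$ such that $\langle u,\nu\rangle=c$ for every $u\in E_K$. When these hold, a witness for (ii) is $(\nu,c)=(p_0,\|p_0\|^2)$ with $p_0:=P_{\operatorname{cl}\operatorname{aff}(E_K)}(0)$; in this case, with $d:=-p_0$, one has $\langle d,u\rangle=-\|d\|^2$ for every $u\in E_K$.
   Context: $\langle\cdot,\cdot\rangle$ and $\|\cdot\|$ are the Euclidean inner product and norm on $\mathbb{R}^n$. For a closed convex cone $K\subset\mathbb{R}^n$, the extremal section is $E_K:=\{u\in\mathbb{R}^n:\|u\|=1,\ \mathbb{R}_+u\text{ is an extreme ray of }K\}$. $\operatorname{cl}\operatorname{aff}(E_K)$ is the closure of the affine hull of $E_K$ and $P_A$ denotes orthogonal projection onto a nonempty closed affine set $A$. *)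

theory Defs
  imports "HOL-Analysis.Analysis"
begin

definition ray :: "'a::real_vector \<Rightarrow> 'a set" where
  "ray u = {t *\<^sub>R u | t. 0 \<le> t}"

text \<open>An extreme ray is a half-line that is a face of the cone.  The generator must be nonzero,
  since otherwise the face \<open>{0}\<close> of a pointed cone would be counted.\<close>

definition extreme_ray_of :: "'a::real_vector set \<Rightarrow> 'a set \<Rightarrow> bool" (infixr \<open>extreme'_ray'_of\<close> 50) where
  "R extreme_ray_of K \<longleftrightarrow> (\<exists>u. u \<noteq> 0 \<and> R = ray u) \<and> R face_of K"

definition extremal_section :: "'a::real_normed_vector set \<Rightarrow> 'a set" where
  "extremal_section K = {u. norm u = 1 \<and> ray u extreme_ray_of K}"

end

theory Submission
  imports Defs
begin

text \<open>Let \<open>A\<close> be the closed affine hull of the extremal section and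
  \<open>p\<close> its point nearest to 0. The segment from 0 to \<open>p\<close> is orthogonal to
  \<open>A\<close>, so \<open>x \<bullet> p\<close> has the constant value
  \<open>p \<bullet> p\<close> on \<open>A\<close> (\<open>inner_closest_point_affine_0\<close>). If
  0 lies outside \<open>A\<close>, then \<open>p\<close> is nonzero and is itself the required
  normal. Conversely, a hyperplane at nonzero level containing the section also contains
  \<open>A\<close>, and it misses 0 (\<open>zero_notin_closure_affine_hull\<close>).\<close>

lemma closest_point_affine_orthogonal:
  fixes A :: "'a::euclidean_space set"
  assumes "affine A" "closed A" "x \<in> A"
  shows "(a - closest_point A a) \<bullet> (x - closest_point A a) = 0"
proof -
  let ?p = "closest_point A a"
  have "?p \<in> A"
    using assms closest_point_in_set by blast
  \<comment> \<open>This is the reflection of \<open>x\<close> through \<open>?p\<close>. The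
    obtuse-angle inequality for the closest point, applied to \<open>x\<close> and to its
    reflection, bounds the inner product from both sides by 0.\<close>
  then have "2 *\<^sub>R ?p + (-1) *\<^sub>R x \<in> A"
    using assms by (intro mem_affine) auto
  then have "(a - ?p) \<bullet> (2 *\<^sub>R ?p + (-1) *\<^sub>R x - ?p) \<le> 0"
    using assms closest_point_dot affine_imp_convex by blast
  moreover have "2 *\<^sub>R ?p + (-1) *\<^sub>R x - ?p = - (x - ?p)"
    by (simp add: scaleR_2)
  moreover have "(a - ?p) \<bullet> (x - ?p) \<le> 0"
    using assms closest_point_dot affine_imp_convex by blast
  ultimately show ?thesis
    by (simp only: inner_minus_right)
qed

lemma inner_closest_point_affine_0:
  fixes A :: "'a::euclidean_space set"
  assumes "affine A" "closed A" "x \<in> A"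
  shows "x \<bullet> closest_point A 0 = (norm (closest_point A 0))\<^sup>2"
  using closest_point_affine_orthogonal[OF assms, of 0]
  by (simp add: inner_diff_right power2_norm_eq_inner inner_commute)

text \<open>A hyperplane is both affine and closed, so it absorbs first the affine hull and then the
  closure; at level \<open>c \<noteq> 0\<close> it cannot contain 0.\<close>

lemma zero_notin_closure_affine_hull:
  fixes E :: "'a::euclidean_space set"
  assumes "c \<noteq> 0" "\<And>u. u \<in> E \<Longrightarrow> u \<bullet> \<nu> = c"
  shows "0 \<notin> closure (affine hull E)"
proof -
  have "affine hull E \<subseteq> {x. \<nu> \<bullet> x = c}"
    using assms by (intro hull_minimal affine_hyperplane) (auto simp: inner_commute)
  then have "closure (affine hull E) \<subseteq> {x. \<nu> \<bullet> x = c}"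
    by (intro closure_minimal closed_hyperplane)
  then show ?thesis
    using \<open>c \<noteq> 0\<close> by auto
qed

theorem lemma6p2:
  fixes K :: "(real ^ 'n) set"
  assumes "closed K" and "convex_cone K" and "extremal_section K \<noteq> {}"
  shows "(0 \<notin> closure (affine hull extremal_section K) \<longleftrightarrow>
            (\<exists>\<nu> c. \<nu> \<noteq> 0 \<and> c \<noteq> (0::real) \<and> (\<forall>u \<in> extremal_section K. u \<bullet> \<nu> = c))) \<and>
         (0 \<notin> closure (affine hull extremal_section K) \<longrightarrow>
            (let p\<^sub>0 = closest_point (closure (affine hull extremal_section K)) 0; d = - p\<^sub>0 in
               (p\<^sub>0 \<noteq> 0 \<and> (norm p\<^sub>0)\<^sup>2 \<noteq> 0 \<and> (\<forall>u \<in> extremal_section K. u \<bullet> p\<^sub>0 = (norm p\<^sub>0)\<^sup>2)) \<and>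
               (\<forall>u \<in> extremal_section K. d \<bullet> u = - (norm d)\<^sup>2)))"
proof -
  let ?A = "closure (affine hull extremal_section K)"
  define p where "p = closest_point ?A 0"
  \<comment> \<open>In finite dimension the affine hull is already closed, so taking the closure
    keeps it affine.\<close>
  have A: "affine ?A" "closed ?A" "extremal_section K \<subseteq> ?A"
    by (simp_all add: closed_affine_hull hull_subset)
  \<comment> \<open>A nonempty section makes \<open>?A\<close> nonempty, so the nearest point is
    attained in \<open>?A\<close>; hence \<open>p = 0\<close> would force
    \<open>0 \<in> ?A\<close>.\<close>
  then have "p \<in> ?A"
    unfolding p_def using assms(3) by (intro closest_point_in_set) auto
  then have nz: "p \<noteq> 0" if "0 \<notin> ?A"
    using that by auto
  have p: "u \<bullet> p = (norm p)\<^sup>2" if "u \<in> extremal_section K" for u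
    unfolding p_def using A that by (intro inner_closest_point_affine_0) auto
  have "0 \<notin> ?A \<longleftrightarrow> (\<exists>\<nu> c. \<nu> \<noteq> 0 \<and> c \<noteq> (0::real) \<and> (\<forall>u \<in> extremal_section K. u \<bullet> \<nu> = c))"
  proof
    assume "0 \<notin> ?A"
    then show "\<exists>\<nu> c. \<nu> \<noteq> 0 \<and> c \<noteq> (0::real) \<and> (\<forall>u \<in> extremal_section K. u \<bullet> \<nu> = c)"
      using nz p by (intro exI[of _ p] exI[of _ "(norm p)\<^sup>2"]) auto
  qed (use zero_notin_closure_affine_hull in blast)
  then show ?thesis
    using nz p unfolding Let_def p_def[symmetric] by (simp add: inner_commute)
qed

end
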